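(* Let $\mathcal{T}=(\mathbb{T},V,\xi)$ be a strict topological theory with $T1=1$, and let $A=(A,a)$ be a $\mathcal{T}$-graph whose underlying $V$-graph $SA$ is a $V$-category. The following assertions are equivalent. (i) $A$ is $\mathcal{T}$-cocomplete (i.e. $SA$ has all tensors and $A$ has all $\mathcal{T}$-colimits). (ii) $A$ has all tensors and all $\mathcal{T}$-suprema. (iii) ($A$ has all tensors and) each $\mathcal{T}$-generated $V$-distributor $\varphi\colon1\to A$ in $P(A)$ has a supremum $\sup_A(\varphi)$ in $A$.
   Context: **Quantales and theories.** $V=(V,\bigvee,\otimes,k)$ is a commutative quantale: a complete lattice with a commutative associative operation $\otimes$ with unit $k$, preserving suprema in each variable; $\hom$ is defined by $x\otimes y\le z\iff x\le\hom(y,z)$. A strict topological theory $\mathcal{T}=(\mathbb{T},V,\xi)$ consists of a monad $\mathbb{T}=(T,m,e)$ on $\mathrm{Set}$, a commutative quantale $V$ and a map $\xi\colon TV\to V$ such that: (a) $T$ sends pullbacks to weak pullbacks and every naturality square of $m$ is a weak pullback; (b) $(V,\xi)$ is an Eilenberg–Moore $\mathbb{T}$-algebra, and $\otimes\colon V\times V\to V$ and $k\colon 1\to V$ are $\mathbb{T}$-homomorphisms, i.e. $\xi(T(\otimes)(w))=\xi(T\pi_1(w))\otimes\xi(T\pi_2(w))$ for $w\in T(V\times V)$ and $\xi(T(k)(t))=k$ for $t\in T1$; (c) the maps $\xi_X\colon V^X\to V^{TX}$, $\varphi\mapsto\xi\cdot T\varphi$ (on sets of functions, pointwise order) are monotone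 and natural: for $f\colon X\to Y$ and $\varphi\colon X\to V$, with $(P_Vf)(\varphi)(y)=\bigvee_{f(x)=y}\varphi(x)$, one has $\xi_Y(P_Vf(\varphi))=P_V(Tf)(\xi_X(\varphi))$. Here $T1=1$ means that $T$ of a one-element set is a one-element set. **$\mathcal{T}$-graphs.** A $\mathcal{T}$-graph $(A,a)$ is a set with a map $a\colon TA\times A\to V$ such that $k\le a(e_A(x),x)$ for all $x$. A $\mathcal{T}$-graph morphism $f\colon(A,a)\to(B,b)$ is a map with $a(\mathfrak{x},x)\le b(Tf(\mathfrak{x}),f(x))$ for all $\mathfrak{x}\in TA,x\in A$. The underlying $V$-graph $SA$ is $A$ with $A(x',x)=a(e_A(x'),x)$; it is a $V$-category if moreover $A(x,y)\otimes A(y,z)\le A(x,z)$. A $\mathbb{T}$-algebra $(I,\alpha)$ is viewed as a $\mathcal{T}$-graph with structure $(\mathfrak{i},i)\mapsto k$ if $\alpha(\mathfrak{i})=i$, $\bot$ otherwise. **$V$-categorical notions.** A $V$-distributor $\varphi\colon 1\to A$ is a map $\varphi\colon A\to V$ with $A(x,y)\otimes\varphi(y)\le\varphi(x)$; $P(A)$ denotes the $V$-category of these. $\sup_A\varphi$ is an object with $A(\sup_A\varphi,y)=\bigwedge_x\hom(\varphi(x),A(x,y))$ for all $y$. For a $V$-distributor $\psi\colon1\to I$ and a $V$-functor $h\colon I\to A$, the colimit is an object $c$ with $A(c,y)=\bigwedge_i\hom(\psi(i),A(h(i),y))$ for all $y$. The tensor of $v\in V$ and $x\in A$ is an object $v\otimes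 x$ with $A(v\otimes x,y)=\hom(v,A(x,y))$. The supremum of a family $(x_i)_{i\in I}$ in $A$ is understood $V$-categorically: an object $s$ with $A(s,y)=\bigwedge_iA(x_i,y)$. **$\mathcal{T}$-notions.** A $\mathcal{T}$-diagram in $A$ is a $\mathcal{T}$-graph morphism $D\colon I\to A$ where $I$ is a $\mathbb{T}$-algebra; a $\mathcal{T}$-supremum is a supremum of the family $(D(i))_{i\in I}$ for a $\mathcal{T}$-diagram $D$. The following are defined for $A$ whose underlying $V$-category has all tensors. A $\mathcal{T}$-weighted diagram in $A$ is a set $I$ together with a $\mathbb{T}$-algebra structure and a $V$-category structure on $I$, a $V$-functor $h\colon I\to A$ and a $V$-distributor $\psi\colon1\to I$ such that $I\to A$, $i\mapsto\psi(i)\otimes h(i)$ is a $\mathcal{T}$-graph morphism (tensors being determined up to isomorphism, this means: for some choice of tensors). Its colimit is called a $\mathcal{T}$-colimit; $A$ is $\mathcal{T}$-cocomplete if all $\mathcal{T}$-colimits exist in $A$. A $V$-distributor $\varphi\colon1\to A$ is $\mathcal{T}$-generated if $\varphi=h_*\cdot\psi$, i.e. $\varphi(x)=\bigvee_{i\in I}A(x,h(i))\otimes\psi(i)$, for some $h$ and $\psi$ as in a $\mathcal{T}$-weighted diagram. *)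

theory Defs
  imports Main "HOL-Library.FuncSet"
begin

section \<open>Commutative quantales\<close>

text \<open>The tensor is written \<open>*\<close> and its unit \<open>k\<close> is written \<open>1\<close>.\<close>

class comm_quantale = complete_lattice + comm_monoid_mult +
  assumes Sup_mult_distrib: "Sup S * y = (SUP x\<in>S. x * y)"

definition qhom :: "'v::comm_quantale \<Rightarrow> 'v \<Rightarrow> 'v" where
  "qhom y z = Sup {x. x * y \<le> z}"

lemma mult_right_mono_quantale:
  fixes x y z :: "'v::comm_quantale"
  assumes "x \<le> y"
  shows "x * z \<le> y * z"
proof -
  have "y * z = (SUP u\<in>{x, y}. u * z)"
    using Sup_mult_distrib[of "{x, y}" z] assms by (simp add: sup_absorb2)
  then show ?thesis by (simp add: le_iff_sup)
qed

lemma qhom_adjunction: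
  fixes x y z :: "'v::comm_quantale"
  shows "x * y \<le> z \<longleftrightarrow> x \<le> qhom y z"
proof
  assume "x * y \<le> z"
  then show "x \<le> qhom y z"
    unfolding qhom_def by (intro Sup_upper) simp
next
  assume "x \<le> qhom y z"
  then have "x * y \<le> qhom y z * y"
    by (rule mult_right_mono_quantale)
  also have "\<dots> \<le> z"
    unfolding qhom_def Sup_mult_distrib by (rule SUP_least) simp
  finally show "x * y \<le> z" .
qed


section \<open>The category of sets\<close>

text \<open>
  HOL cannot quantify over type constructors, so a monad on Set cannot be a parameter that
  acts on types. The objects of Set are therefore represented as the members of a family \<open>small U\<close> of subsets of one type \<open>'u\<close>, and the morphisms from \<open>X\<close> to \<open>Y\<close> as
  functions \<open>f \<in> X \<rightarrow> Y\<close> considered up to equality on \<open>X\<close>. Only the closure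
  properties used to formulate the notions below are required. Examples are the sets of a
  Grothendieck universe, the sets (as opposed to proper classes) when \<open>'u\<close> is a type
  modelling ZFC, and all subsets of an arbitrary infinite type. The field \<open>pair\<close> codes
  ordered pairs, so that binary products of small sets are again subsets of \<open>'u\<close>.
\<close>

record 'u universe =
  small :: "'u set set"
  pair :: "'u \<times> 'u \<Rightarrow> 'u"

definition prodset :: "('u, 'x) universe_scheme \<Rightarrow> 'u set \<Rightarrow> 'u set \<Rightarrow> 'u set" where
  "prodset U X Y = pair U ` (X \<times> Y)"

definition proj1 :: "('u, 'x) universe_scheme \<Rightarrow> 'u \<Rightarrow> 'u" where
  "proj1 U z = fst (inv (pair U) z)"

definition proj2 :: "('u, 'x) universe_scheme \<Rightarrow> 'u \<Rightarrow> 'u" where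
  "proj2 U z = snd (inv (pair U) z)"

locale set_universe =
  fixes U :: "'u universe"
  assumes inj_pair: "inj (pair U)"
    and small_nonempty: "\<exists>X\<in>small U. X \<noteq> {}"
    and small_subset: "X \<in> small U \<Longrightarrow> Y \<subseteq> X \<Longrightarrow> Y \<in> small U"
    and small_image: "X \<in> small U \<Longrightarrow> f ` X \<in> small U"
    and small_prod: "X \<in> small U \<Longrightarrow> Y \<in> small U \<Longrightarrow> prodset U X Y \<in> small U"

text \<open>The squares below have sides \<open>p : P \<rightarrow> Y\<close>, \<open>q : P \<rightarrow> Z\<close>, \<open>f : Y \<rightarrow> W\<close> and \<open>g : Z \<rightarrow> W\<close>.\<close>

definition comm_square ::
  "'u universe \<Rightarrow> 'u set \<Rightarrow> 'u set \<Rightarrow> 'u set \<Rightarrow> 'u set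
    \<Rightarrow> ('u \<Rightarrow> 'u) \<Rightarrow> ('u \<Rightarrow> 'u) \<Rightarrow> ('u \<Rightarrow> 'u) \<Rightarrow> ('u \<Rightarrow> 'u) \<Rightarrow> bool" where
  "comm_square U P Y Z W p q f g \<longleftrightarrow>
     P \<in> small U \<and> Y \<in> small U \<and> Z \<in> small U \<and> W \<in> small U \<and>
     p \<in> P \<rightarrow> Y \<and> q \<in> P \<rightarrow> Z \<and> f \<in> Y \<rightarrow> W \<and> g \<in> Z \<rightarrow> W \<and>
     (\<forall>x\<in>P. f (p x) = g (q x))"

definition weak_pullback ::
  "'u universe \<Rightarrow> 'u set \<Rightarrow> 'u set \<Rightarrow> 'u set \<Rightarrow> 'u set
    \<Rightarrow> ('u \<Rightarrow> 'u) \<Rightarrow> ('u \<Rightarrow> 'u) \<Rightarrow> ('u \<Rightarrow> 'u) \<Rightarrow> ('u \<Rightarrow> 'u) \<Rightarrow> bool" where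
  "weak_pullback U P Y Z W p q f g \<longleftrightarrow>
     comm_square U P Y Z W p q f g \<and>
     (\<forall>C r s. comm_square U C Y Z W r s f g \<longrightarrow>
        (\<exists>u. u \<in> C \<rightarrow>\<^sub>E P \<and> (\<forall>c\<in>C. p (u c) = r c \<and> q (u c) = s c)))"

definition pullback ::
  "'u universe \<Rightarrow> 'u set \<Rightarrow> 'u set \<Rightarrow> 'u set \<Rightarrow> 'u set
    \<Rightarrow> ('u \<Rightarrow> 'u) \<Rightarrow> ('u \<Rightarrow> 'u) \<Rightarrow> ('u \<Rightarrow> 'u) \<Rightarrow> ('u \<Rightarrow> 'u) \<Rightarrow> bool" where
  "pullback U P Y Z W p q f g \<longleftrightarrow>
     comm_square U P Y Z W p q f g \<and>
     (\<forall>C r s. comm_square U C Y Z W r s f g \<longrightarrow>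
        (\<exists>!u. u \<in> C \<rightarrow>\<^sub>E P \<and> (\<forall>c\<in>C. p (u c) = r c \<and> q (u c) = s c)))"


section \<open>Monads on Set and their algebras\<close>

text \<open>
  \<open>arr T X Y f\<close> is the image under \<open>T\<close> of \<open>f : X \<rightarrow> Y\<close>. The codomain is an argument because
  \<open>T\<close> need not send inclusions to inclusions.
\<close>

record 'u monad_data =
  ob :: "'u set \<Rightarrow> 'u set"
  arr :: "'u set \<Rightarrow> 'u set \<Rightarrow> ('u \<Rightarrow> 'u) \<Rightarrow> 'u \<Rightarrow> 'u"
  mu :: "'u set \<Rightarrow> 'u \<Rightarrow> 'u"
  eta :: "'u set \<Rightarrow> 'u \<Rightarrow> 'u"

locale set_monad = set_universe U
  for U :: "'u universe" +
  fixes T :: "'u monad_data"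
  assumes ob_small: "X \<in> small U \<Longrightarrow> ob T X \<in> small U"
    and arr_closed:
      "X \<in> small U \<Longrightarrow> Y \<in> small U \<Longrightarrow> f \<in> X \<rightarrow> Y \<Longrightarrow> arr T X Y f \<in> ob T X \<rightarrow> ob T Y"
    and arr_cong:
      "X \<in> small U \<Longrightarrow> Y \<in> small U \<Longrightarrow> f \<in> X \<rightarrow> Y \<Longrightarrow> (\<And>x. x \<in> X \<Longrightarrow> f x = g x) \<Longrightarrow> t \<in> ob T X
       \<Longrightarrow> arr T X Y f t = arr T X Y g t"
    and arr_id:
      "X \<in> small U \<Longrightarrow> t \<in> ob T X \<Longrightarrow> arr T X X (\<lambda>x. x) t = t"
    and arr_comp:
      "X \<in> small U \<Longrightarrow> Y \<in> small U \<Longrightarrow> Z \<in> small U \<Longrightarrow> f \<in> X \<rightarrow> Y \<Longrightarrow> g \<in> Y \<rightarrow> Z \<Longrightarrow> t \<in> ob T X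
       \<Longrightarrow> arr T X Z (\<lambda>x. g (f x)) t = arr T Y Z g (arr T X Y f t)"
    and eta_closed: "X \<in> small U \<Longrightarrow> eta T X \<in> X \<rightarrow> ob T X"
    and eta_natural:
      "X \<in> small U \<Longrightarrow> Y \<in> small U \<Longrightarrow> f \<in> X \<rightarrow> Y \<Longrightarrow> x \<in> X
       \<Longrightarrow> arr T X Y f (eta T X x) = eta T Y (f x)"
    and mu_closed: "X \<in> small U \<Longrightarrow> mu T X \<in> ob T (ob T X) \<rightarrow> ob T X"
    and mu_natural:
      "X \<in> small U \<Longrightarrow> Y \<in> small U \<Longrightarrow> f \<in> X \<rightarrow> Y \<Longrightarrow> w \<in> ob T (ob T X)
       \<Longrightarrow> arr T X Y f (mu T X w) = mu T Y (arr T (ob T X) (ob T Y) (arr T X Y f) w)"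
    and mu_eta: "X \<in> small U \<Longrightarrow> t \<in> ob T X \<Longrightarrow> mu T X (eta T (ob T X) t) = t"
    and mu_arr_eta:
      "X \<in> small U \<Longrightarrow> t \<in> ob T X \<Longrightarrow> mu T X (arr T X (ob T X) (eta T X) t) = t"
    and mu_assoc:
      "X \<in> small U \<Longrightarrow> w \<in> ob T (ob T (ob T X))
       \<Longrightarrow> mu T X (mu T (ob T X) w) = mu T X (arr T (ob T (ob T X)) (ob T X) (mu T X) w)"

definition T_algebra :: "'u universe \<Rightarrow> 'u monad_data \<Rightarrow> 'u set \<Rightarrow> ('u \<Rightarrow> 'u) \<Rightarrow> bool" where
  "T_algebra U T I \<alpha> \<longleftrightarrow>
     I \<in> small U \<and> \<alpha> \<in> ob T I \<rightarrow> I \<and>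
     (\<forall>i\<in>I. \<alpha> (eta T I i) = i) \<and>
     (\<forall>w\<in>ob T (ob T I). \<alpha> (mu T I w) = \<alpha> (arr T (ob T I) I \<alpha> w))"


section \<open>Strict topological theories\<close>

text \<open>
  The quantale \<open>V\<close> is the type \<open>'v\<close>. It is an object of Set through an injection
  \<open>c :: 'v \<Rightarrow> 'u\<close> with small range, so that \<open>T V\<close> is \<open>ob T (range c)\<close>. Maps out of a set
  into \<open>V\<close> take values in \<open>'v\<close>; they are composed with \<open>c\<close> before \<open>T\<close> is applied.
\<close>

definition xi_map ::
  "'u monad_data \<Rightarrow> ('v \<Rightarrow> 'u) \<Rightarrow> ('u \<Rightarrow> 'v) \<Rightarrow> 'u set \<Rightarrow> ('u \<Rightarrow> 'v) \<Rightarrow> 'u \<Rightarrow> 'v" where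
  "xi_map T c \<xi> X \<phi> t = \<xi> (arr T X (range c) (\<lambda>x. c (\<phi> x)) t)"

definition P_V :: "'x set \<Rightarrow> ('x \<Rightarrow> 'y) \<Rightarrow> ('x \<Rightarrow> 'v::comm_quantale) \<Rightarrow> 'y \<Rightarrow> 'v" where
  "P_V X f \<phi> y = (SUP x\<in>{x\<in>X. f x = y}. \<phi> x)"

locale strict_topological_theory = set_monad U T
  for U :: "'u universe" and T :: "'u monad_data" +
  fixes c :: "'v::comm_quantale \<Rightarrow> 'u" and \<xi> :: "'u \<Rightarrow> 'v"
  assumes inj_c: "inj c"
    and small_V: "range c \<in> small U"
    and T_pullback:
      "pullback U P X Y Z p q f g \<Longrightarrow>
       weak_pullback U (ob T P) (ob T X) (ob T Y) (ob T Z)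
         (arr T P X p) (arr T P Y q) (arr T X Z f) (arr T Y Z g)"
    and mu_weak_pullback:
      "X \<in> small U \<Longrightarrow> Y \<in> small U \<Longrightarrow> f \<in> X \<rightarrow> Y \<Longrightarrow>
       weak_pullback U (ob T (ob T X)) (ob T (ob T Y)) (ob T X) (ob T Y)
         (arr T (ob T X) (ob T Y) (arr T X Y f)) (mu T X) (mu T Y) (arr T X Y f)"
    and xi_algebra: "T_algebra U T (range c) (\<lambda>t. c (\<xi> t))"
    and xi_tensor:
      "w \<in> ob T (prodset U (range c) (range c)) \<Longrightarrow>
       \<xi> (arr T (prodset U (range c) (range c)) (range c)
            (\<lambda>z. c (inv c (proj1 U z) * inv c (proj2 U z))) w)
       = \<xi> (arr T (prodset U (range c) (range c)) (range c) (proj1 U) w)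
         * \<xi> (arr T (prodset U (range c) (range c)) (range c) (proj2 U) w)"
    and xi_unit: "t \<in> ob T {x} \<Longrightarrow> \<xi> (arr T {x} (range c) (\<lambda>_. c 1) t) = 1"
    and xi_mono:
      "X \<in> small U \<Longrightarrow> (\<And>x. x \<in> X \<Longrightarrow> \<phi> x \<le> \<phi>' x) \<Longrightarrow> t \<in> ob T X
       \<Longrightarrow> xi_map T c \<xi> X \<phi> t \<le> xi_map T c \<xi> X \<phi>' t"
    and xi_natural:
      "X \<in> small U \<Longrightarrow> Y \<in> small U \<Longrightarrow> f \<in> X \<rightarrow> Y \<Longrightarrow> t \<in> ob T Y
       \<Longrightarrow> xi_map T c \<xi> Y (P_V X f \<phi>) t
           = P_V (ob T X) (arr T X Y f) (xi_map T c \<xi> X \<phi>) t"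

definition T_one_eq_one :: "'u monad_data \<Rightarrow> bool" where
  "T_one_eq_one T \<longleftrightarrow> (\<forall>x. \<exists>y. ob T {x} = {y})"


section \<open>\<open>T\<close>-graphs\<close>

definition T_graph ::
  "'u universe \<Rightarrow> 'u monad_data \<Rightarrow> 'u set \<Rightarrow> ('u \<Rightarrow> 'u \<Rightarrow> 'v::comm_quantale) \<Rightarrow> bool" where
  "T_graph U T A a \<longleftrightarrow> A \<in> small U \<and> (\<forall>x\<in>A. 1 \<le> a (eta T A x) x)"

definition T_graph_morphism ::
  "'u monad_data \<Rightarrow> 'u set \<Rightarrow> ('u \<Rightarrow> 'u \<Rightarrow> 'v::comm_quantale)
    \<Rightarrow> 'u set \<Rightarrow> ('u \<Rightarrow> 'u \<Rightarrow> 'v) \<Rightarrow> ('u \<Rightarrow> 'u) \<Rightarrow> bool" where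
  "T_graph_morphism T A a B b f \<longleftrightarrow>
     f \<in> A \<rightarrow> B \<and> (\<forall>t\<in>ob T A. \<forall>x\<in>A. a t x \<le> b (arr T A B f t) (f x))"

definition underlying ::
  "'u monad_data \<Rightarrow> 'u set \<Rightarrow> ('u \<Rightarrow> 'u \<Rightarrow> 'v) \<Rightarrow> 'u \<Rightarrow> 'u \<Rightarrow> 'v" where
  "underlying T A a x y = a (eta T A x) y"

definition alg_graph :: "('u \<Rightarrow> 'u) \<Rightarrow> 'u \<Rightarrow> 'u \<Rightarrow> 'v::comm_quantale" where
  "alg_graph \<alpha> t i = (if \<alpha> t = i then 1 else bot)"

lemma T_graph_alg_graph: "T_algebra U T I \<alpha> \<Longrightarrow> T_graph U T I (alg_graph \<alpha>)"
  by (simp add: T_algebra_def T_graph_def alg_graph_def)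


section \<open>\<open>V\<close>-categories\<close>

definition V_category :: "'x set \<Rightarrow> ('x \<Rightarrow> 'x \<Rightarrow> 'v::comm_quantale) \<Rightarrow> bool" where
  "V_category A d \<longleftrightarrow>
     (\<forall>x\<in>A. 1 \<le> d x x) \<and> (\<forall>x\<in>A. \<forall>y\<in>A. \<forall>z\<in>A. d x y * d y z \<le> d x z)"

definition V_functor ::
  "'x set \<Rightarrow> ('x \<Rightarrow> 'x \<Rightarrow> 'v::comm_quantale) \<Rightarrow> 'y set \<Rightarrow> ('y \<Rightarrow> 'y \<Rightarrow> 'v) \<Rightarrow> ('x \<Rightarrow> 'y) \<Rightarrow> bool" where
  "V_functor A d B d' f \<longleftrightarrow>
     f \<in> A \<rightarrow> B \<and> (\<forall>x\<in>A. \<forall>y\<in>A. d x y \<le> d' (f x) (f y))"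

definition V_distributor ::
  "'x set \<Rightarrow> ('x \<Rightarrow> 'x \<Rightarrow> 'v::comm_quantale) \<Rightarrow> ('x \<Rightarrow> 'v) \<Rightarrow> bool" where
  "V_distributor A d \<phi> \<longleftrightarrow> (\<forall>x\<in>A. \<forall>y\<in>A. d x y * \<phi> y \<le> \<phi> x)"

definition is_sup_of_distributor ::
  "'x set \<Rightarrow> ('x \<Rightarrow> 'x \<Rightarrow> 'v::comm_quantale) \<Rightarrow> ('x \<Rightarrow> 'v) \<Rightarrow> 'x \<Rightarrow> bool" where
  "is_sup_of_distributor A d \<phi> s \<longleftrightarrow>
     s \<in> A \<and> (\<forall>y\<in>A. d s y = (INF x\<in>A. qhom (\<phi> x) (d x y)))"

definition is_colimit ::
  "'x set \<Rightarrow> ('x \<Rightarrow> 'x \<Rightarrow> 'v::comm_quantale) \<Rightarrow> 'i set \<Rightarrow> ('i \<Rightarrow> 'v) \<Rightarrow> ('i \<Rightarrow> 'x) \<Rightarrow> 'x \<Rightarrow> bool" where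
  "is_colimit A d I \<psi> h s \<longleftrightarrow>
     s \<in> A \<and> (\<forall>y\<in>A. d s y = (INF i\<in>I. qhom (\<psi> i) (d (h i) y)))"

definition is_tensor ::
  "'x set \<Rightarrow> ('x \<Rightarrow> 'x \<Rightarrow> 'v::comm_quantale) \<Rightarrow> 'v \<Rightarrow> 'x \<Rightarrow> 'x \<Rightarrow> bool" where
  "is_tensor A d v x t \<longleftrightarrow> t \<in> A \<and> (\<forall>y\<in>A. d t y = qhom v (d x y))"

definition is_family_sup ::
  "'x set \<Rightarrow> ('x \<Rightarrow> 'x \<Rightarrow> 'v::comm_quantale) \<Rightarrow> 'i set \<Rightarrow> ('i \<Rightarrow> 'x) \<Rightarrow> 'x \<Rightarrow> bool" where
  "is_family_sup A d I D s \<longleftrightarrow>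
     s \<in> A \<and> (\<forall>y\<in>A. d s y = (INF i\<in>I. d (D i) y))"

definition has_tensors :: "'x set \<Rightarrow> ('x \<Rightarrow> 'x \<Rightarrow> 'v::comm_quantale) \<Rightarrow> bool" where
  "has_tensors A d \<longleftrightarrow> (\<forall>v. \<forall>x\<in>A. \<exists>t. is_tensor A d v x t)"


section \<open>\<open>T\<close>-suprema and \<open>T\<close>-colimits\<close>

definition T_diagram ::
  "'u universe \<Rightarrow> 'u monad_data \<Rightarrow> 'u set \<Rightarrow> ('u \<Rightarrow> 'u \<Rightarrow> 'v::comm_quantale)
    \<Rightarrow> 'u set \<Rightarrow> ('u \<Rightarrow> 'u) \<Rightarrow> ('u \<Rightarrow> 'u) \<Rightarrow> bool" where
  "T_diagram U T A a I \<alpha> D \<longleftrightarrow>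
     T_algebra U T I \<alpha> \<and> T_graph_morphism T I (alg_graph \<alpha>) A a D"

definition has_T_suprema ::
  "'u universe \<Rightarrow> 'u monad_data \<Rightarrow> 'u set \<Rightarrow> ('u \<Rightarrow> 'u \<Rightarrow> 'v::comm_quantale) \<Rightarrow> bool" where
  "has_T_suprema U T A a \<longleftrightarrow>
     (\<forall>I \<alpha> D. T_diagram U T A a I \<alpha> D \<longrightarrow> (\<exists>s. is_family_sup A (underlying T A a) I D s))"

text \<open>
  A weighted diagram consists of a set \<open>I\<close>, an algebra structure \<open>\<alpha>\<close> and a \<open>V\<close>-category
  structure \<open>r\<close> on \<open>I\<close>, which need not be related, the \<open>V\<close>-functor \<open>h\<close> and the weight \<open>\<psi>\<close>.
\<close>

definition T_weighted_diagram ::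
  "'u universe \<Rightarrow> 'u monad_data \<Rightarrow> 'u set \<Rightarrow> ('u \<Rightarrow> 'u \<Rightarrow> 'v::comm_quantale)
    \<Rightarrow> 'u set \<Rightarrow> ('u \<Rightarrow> 'u) \<Rightarrow> ('u \<Rightarrow> 'u \<Rightarrow> 'v) \<Rightarrow> ('u \<Rightarrow> 'u) \<Rightarrow> ('u \<Rightarrow> 'v) \<Rightarrow> bool" where
  "T_weighted_diagram U T A a I \<alpha> r h \<psi> \<longleftrightarrow>
     T_algebra U T I \<alpha> \<and> V_category I r \<and>
     V_functor I r A (underlying T A a) h \<and> V_distributor I r \<psi> \<and>
     (\<exists>t. (\<forall>i\<in>I. is_tensor A (underlying T A a) (\<psi> i) (h i) (t i)) \<and>
          T_graph_morphism T I (alg_graph \<alpha>) A a t)"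

definition T_cocomplete ::
  "'u universe \<Rightarrow> 'u monad_data \<Rightarrow> 'u set \<Rightarrow> ('u \<Rightarrow> 'u \<Rightarrow> 'v::comm_quantale) \<Rightarrow> bool" where
  "T_cocomplete U T A a \<longleftrightarrow>
     has_tensors A (underlying T A a) \<and>
     (\<forall>I \<alpha> r h \<psi>. T_weighted_diagram U T A a I \<alpha> r h \<psi> \<longrightarrow>
        (\<exists>s. is_colimit A (underlying T A a) I \<psi> h s))"

definition T_generated ::
  "'u universe \<Rightarrow> 'u monad_data \<Rightarrow> 'u set \<Rightarrow> ('u \<Rightarrow> 'u \<Rightarrow> 'v::comm_quantale)
    \<Rightarrow> ('u \<Rightarrow> 'v) \<Rightarrow> bool" where
  "T_generated U T A a \<phi> \<longleftrightarrow>
     (\<exists>I \<alpha> r h \<psi>. T_weighted_diagram U T A a I \<alpha> r h \<psi> \<and>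
        (\<forall>x\<in>A. \<phi> x = (SUP i\<in>I. underlying T A a x (h i) * \<psi> i)))"

end

theory Submission
  imports Defs
begin

text \<open>
  A \<open>T\<close>-supremum is the \<open>T\<close>-colimit over a discrete \<open>V\<close>-category with constant weight \<open>k\<close>, and
  conversely the colimit of a weighted diagram is the supremum of the family of tensors
  \<open>\<psi>(i) \<otimes> h(i)\<close>, which is a \<open>T\<close>-diagram by assumption. Finally, the supremum of
  \<open>h\<^sub>* \<cdot> \<psi>\<close> has the universal property of the colimit of \<open>h\<close> weighted by \<open>\<psi>\<close>.
\<close>

lemma bot_mult_quantale [simp]: "bot * x = (bot :: 'v::comm_quantale)"
  using Sup_mult_distrib[of "{}" x] by simp

lemma qhom_one [simp]: "qhom 1 z = z"
  for z :: "'v::comm_quantale"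
  by (rule order_antisym) (metis qhom_adjunction mult_1_right order_refl)+

lemma SUP_mult_le_iff:
  fixes f :: "'i \<Rightarrow> 'v::comm_quantale"
  shows "w * (SUP i\<in>I. f i) \<le> z \<longleftrightarrow> (\<forall>i\<in>I. w * f i \<le> z)"
proof -
  have "w * (SUP i\<in>I. f i) = (SUP i\<in>I. w * f i)"
    using Sup_mult_distrib[of "f ` I" w] by (simp add: image_image mult.commute)
  then show ?thesis by (simp add: SUP_le_iff)
qed

text \<open>The composition law of \<open>A\<close> absorbs the extra factor, since
  \<open>d x y * d y (h i)\<close> lies below \<open>d x (h i)\<close>. Hence the composite of
  \<open>h\<close> and \<open>\<psi>\<close> is among the distributors over which the third
  assertion quantifies.\<close>

lemma V_distributor_generated:
  fixes d :: "'x \<Rightarrow> 'x \<Rightarrow> 'v::comm_quantale"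
  assumes "V_category A d" and "h \<in> I \<rightarrow> A"
    and gen: "\<And>x. x \<in> A \<Longrightarrow> \<phi> x = (SUP i\<in>I. d x (h i) * \<psi> i)"
  shows "V_distributor A d \<phi>"
  unfolding V_distributor_def
proof (intro ballI)
  fix x y assume xy: "x \<in> A" "y \<in> A"
  have "d x y * (d y (h i) * \<psi> i) \<le> \<phi> x" if i: "i \<in> I" for i
  proof -
    have "d x y * d y (h i) \<le> d x (h i)"
      using assms(1) xy funcset_mem[OF assms(2) i] by (simp add: V_category_def)
    then have "d x y * (d y (h i) * \<psi> i) \<le> d x (h i) * \<psi> i"
      using mult_right_mono_quantale by (metis mult.assoc)
    also have "\<dots> \<le> \<phi> x" unfolding gen[OF xy(1)] using i by (rule SUP_upper)
    finally show ?thesis .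
  qed
  then show "d x y * \<phi> y \<le> \<phi> x" by (simp add: gen[OF xy(2)] SUP_mult_le_iff)
qed

text \<open>Both infima have the same lower bounds. One direction evaluates at
  \<open>x = h i\<close> and uses reflexivity of \<open>d\<close>, as in the Yoneda lemma; the other
  composes through \<open>h i\<close>.\<close>

lemma INF_qhom_generated:
  fixes d :: "'x \<Rightarrow> 'x \<Rightarrow> 'v::comm_quantale"
  assumes "V_category A d" and h: "h \<in> I \<rightarrow> A"
    and gen: "\<And>x. x \<in> A \<Longrightarrow> \<phi> x = (SUP i\<in>I. d x (h i) * \<psi> i)"
    and y: "y \<in> A"
  shows "(INF x\<in>A. qhom (\<phi> x) (d x y)) = (INF i\<in>I. qhom (\<psi> i) (d (h i) y))"
proof -
  have refl: "\<And>x. x \<in> A \<Longrightarrow> 1 \<le> d x x"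
    and comp: "\<And>x z. x \<in> A \<Longrightarrow> z \<in> A \<Longrightarrow> d x z * d z y \<le> d x y"
    using assms(1) y by (auto simp: V_category_def)
  \<comment> \<open>By the adjunction, the two sides say that \<open>w\<close> is a lower bound of
    the left and of the right infimum.\<close>
  have "(\<forall>x\<in>A. w * \<phi> x \<le> d x y) \<longleftrightarrow> (\<forall>i\<in>I. w * \<psi> i \<le> d (h i) y)" for w
  proof safe
    fix i assume le: "\<forall>x\<in>A. w * \<phi> x \<le> d x y" and i: "i \<in> I"
    have hi: "h i \<in> A" using h i by auto
    have "w * (d (h i) (h i) * \<psi> i) \<le> d (h i) y"
      using le hi i by (auto simp: gen SUP_mult_le_iff)
    \<comment> \<open>The unit is replaced by the larger \<open>d (h i) (h i)\<close>, which gives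
      the summand of \<open>\<phi> (h i)\<close> with index \<open>i\<close>.\<close>
    moreover have "w * \<psi> i \<le> w * (d (h i) (h i) * \<psi> i)"
      using mult_right_mono_quantale[OF refl[OF hi], of "w * \<psi> i"] by (simp add: ac_simps)
    ultimately show "w * \<psi> i \<le> d (h i) y" by (rule order_trans[rotated])
  next
    fix x assume le: "\<forall>i\<in>I. w * \<psi> i \<le> d (h i) y" and x: "x \<in> A"
    have "w * (d x (h i) * \<psi> i) \<le> d x y" if i: "i \<in> I" for i
    proof -
      have "w * (d x (h i) * \<psi> i) \<le> d x (h i) * d (h i) y"
        using mult_right_mono_quantale[of "w * \<psi> i" "d (h i) y" "d x (h i)"] le i
        by (simp add: ac_simps)
      also have "\<dots> \<le> d x y" using comp x h i by auto
      finally show ?thesis .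
    qed
    then show "w * \<phi> x \<le> d x y" by (simp add: gen[OF x] SUP_mult_le_iff)
  qed
  then show ?thesis
    unfolding qhom_adjunction le_INF_iff[symmetric] by (meson order_antisym order_refl)
qed

lemma is_sup_of_generated_iff_is_colimit:
  fixes d :: "'x \<Rightarrow> 'x \<Rightarrow> 'v::comm_quantale"
  assumes "V_category A d" and "h \<in> I \<rightarrow> A"
    and "\<And>x. x \<in> A \<Longrightarrow> \<phi> x = (SUP i\<in>I. d x (h i) * \<psi> i)"
  shows "is_sup_of_distributor A d \<phi> s \<longleftrightarrow> is_colimit A d I \<psi> h s"
  using INF_qhom_generated[OF assms]
  by (simp add: is_sup_of_distributor_def is_colimit_def)

lemma is_colimit_unit_weight_iff:
  fixes d :: "'x \<Rightarrow> 'x \<Rightarrow> 'v::comm_quantale"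
  shows "is_colimit A d I (\<lambda>_. 1) D s \<longleftrightarrow> is_family_sup A d I D s"
  by (simp add: is_colimit_def is_family_sup_def)

text \<open>The universal property of \<open>t i\<close> turns \<open>d (t i) y\<close> into
  \<open>qhom (\<psi> i) (d (h i) y)\<close>, so the two infima agree term by term, whichever
  tensors are chosen.\<close>

lemma is_family_sup_tensors_iff:
  fixes d :: "'x \<Rightarrow> 'x \<Rightarrow> 'v::comm_quantale"
  assumes "\<And>i. i \<in> I \<Longrightarrow> is_tensor A d (\<psi> i) (h i) (t i)"
  shows "is_family_sup A d I t s \<longleftrightarrow> is_colimit A d I \<psi> h s"
  using assms by (simp add: is_colimit_def is_family_sup_def is_tensor_def cong: INF_cong)

text \<open>For the discrete structure, the functor condition reduces to reflexivity in
  \<open>A\<close> and the distributor condition is automatic. Since \<open>D i\<close> is its own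
  tensor with the unit, the required graph morphism is \<open>D\<close> itself.\<close>

lemma T_weighted_diagram_discrete:
  fixes a :: "'u \<Rightarrow> 'u \<Rightarrow> 'v::comm_quantale"
  assumes "V_category A (underlying T A a)" and "T_diagram U T A a I \<alpha> D"
  shows "T_weighted_diagram U T A a I \<alpha> (\<lambda>i j. if i = j then 1 else bot) D (\<lambda>_. 1)"
proof -
  have D: "D \<in> I \<rightarrow> A"
    using assms(2) by (simp add: T_diagram_def T_graph_morphism_def)
  then have "\<forall>i\<in>I. is_tensor A (underlying T A a) 1 (D i) (D i)"
    by (auto simp: is_tensor_def)
  then show ?thesis
    using assms D
    by (auto simp: T_weighted_diagram_def T_diagram_def V_category_def V_functor_def
        V_distributor_def)
qed

theorem proposition2p7:
  fixes U :: "'u universe" and T :: "'u monad_data"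
    and c :: "'v::comm_quantale \<Rightarrow> 'u" and \<xi> :: "'u \<Rightarrow> 'v"
    and A :: "'u set" and a :: "'u \<Rightarrow> 'u \<Rightarrow> 'v"
  assumes "strict_topological_theory U T c \<xi>"
    and "T_one_eq_one T"
    and "T_graph U T A a"
    and "V_category A (underlying T A a)"
  shows "(T_cocomplete U T A a \<longleftrightarrow>
            has_tensors A (underlying T A a) \<and> has_T_suprema U T A a) \<and>
         (T_cocomplete U T A a \<longleftrightarrow>
            has_tensors A (underlying T A a) \<and>
            (\<forall>\<phi>. V_distributor A (underlying T A a) \<phi> \<and> T_generated U T A a \<phi> \<longrightarrow>
               (\<exists>s. is_sup_of_distributor A (underlying T A a) \<phi> s)))"
proof -
  let ?d = "underlying T A a"
  have V: "V_category A ?d" by (rule assms(4))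
  have "has_T_suprema U T A a" if "T_cocomplete U T A a"
    unfolding has_T_suprema_def
  proof (intro allI impI)
    fix I \<alpha> D assume "T_diagram U T A a I \<alpha> D"
    then show "\<exists>s. is_family_sup A ?d I D s"
      using that T_weighted_diagram_discrete[OF V]
      unfolding T_cocomplete_def is_colimit_unit_weight_iff[symmetric] by blast
  qed
  moreover have "T_cocomplete U T A a"
    if "has_tensors A ?d" and sups: "has_T_suprema U T A a"
    unfolding T_cocomplete_def
  proof (intro conjI allI impI)
    fix I \<alpha> r h \<psi> assume "T_weighted_diagram U T A a I \<alpha> r h \<psi>"
    \<comment> \<open>The tensors are those supplied by the weighted diagram, because they are known
      to form a graph morphism and hence a \<open>T\<close>-diagram.\<close>
    then obtain t where t: "\<And>i. i \<in> I \<Longrightarrow> is_tensor A ?d (\<psi> i) (h i) (t i)"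
      and "T_diagram U T A a I \<alpha> t"
      by (auto simp: T_weighted_diagram_def T_diagram_def)
    then show "\<exists>s. is_colimit A ?d I \<psi> h s"
      using sups is_family_sup_tensors_iff[of I A ?d \<psi> h t] unfolding has_T_suprema_def by metis
  qed (rule that)
  moreover have "\<exists>s. is_sup_of_distributor A ?d \<phi> s"
    if cocomplete: "T_cocomplete U T A a" and generated: "T_generated U T A a \<phi>" for \<phi>
  proof -
    obtain I \<alpha> r h \<psi> where w: "T_weighted_diagram U T A a I \<alpha> r h \<psi>"
      and gen: "\<And>x. x \<in> A \<Longrightarrow> \<phi> x = (SUP i\<in>I. ?d x (h i) * \<psi> i)"
      using generated unfolding T_generated_def by blast
    have "h \<in> I \<rightarrow> A" using w by (simp add: T_weighted_diagram_def V_functor_def)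
    then show ?thesis
      using cocomplete w is_sup_of_generated_iff_is_colimit[OF V _ gen]
      unfolding T_cocomplete_def by blast
  qed
  moreover have "T_cocomplete U T A a"
    if "has_tensors A ?d"
      and sups: "\<forall>\<phi>. V_distributor A ?d \<phi> \<and> T_generated U T A a \<phi> \<longrightarrow>
        (\<exists>s. is_sup_of_distributor A ?d \<phi> s)"
    unfolding T_cocomplete_def
  proof (intro conjI allI impI)
    fix I \<alpha> r h \<psi> assume w: "T_weighted_diagram U T A a I \<alpha> r h \<psi>"
    \<comment> \<open>This is the composite of \<open>h\<close> and \<open>\<psi>\<close>, whose
      supremum will be the desired colimit.\<close>
    define \<phi> where "\<phi> x = (SUP i\<in>I. ?d x (h i) * \<psi> i)" for x
    have h: "h \<in> I \<rightarrow> A" using w by (simp add: T_weighted_diagram_def V_functor_def)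
    have "T_generated U T A a \<phi>"
      unfolding T_generated_def using w \<phi>_def by blast
    with sups V_distributor_generated[OF V h \<phi>_def] obtain s
      where "is_sup_of_distributor A ?d \<phi> s" by blast
    then show "\<exists>s. is_colimit A ?d I \<psi> h s"
      using is_sup_of_generated_iff_is_colimit[OF V h \<phi>_def] by blast
  qed (rule that)
  \<comment> \<open>Unfolding \<open>T_cocomplete\<close> exposes its first conjunct, which provides
    the tensors in the second and third assertions.\<close>
  ultimately show ?thesis
    unfolding T_cocomplete_def by blast
qed

end
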